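(* Let $\alpha$ be a real number with $1<\alpha<2$, and let $x_0=x_0(\alpha)$ be the unique positive solution of the equation $$x^{\alpha-1}-\frac{\pi}{e^2\sqrt{3}}\,x+1=0.$$ Then for each positive integer $n>x_0$ there exist at least $\lfloor n^\alpha\rfloor$ primes strictly between $p_{n+1}$ and the product $p_1p_2\cdots p_{n+1}$. Moreover, for each positive integer $n$ there are at least $n$ primes strictly between $p_{n+1}$ and the product $p_1p_2\cdots p_{n+1}$.
   Context: $p_k$ denotes the $k$-th prime ($p_1=2,p_2=3,\dots$). $\lfloor a\rfloor$ denotes the integer part of the real number $a$. *)

theory Defs
  imports Complex_Main "HOL-Library.Infinite_Set" "HOL-Computational_Algebra.Primes"
begin

text \<open>
  The numbering starts at 1, so \<open>nth_prime 1 = 2\<close>, whereas \<^const>\<open>enumerate\<close> starts at 0.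
  The value \<open>nth_prime 0\<close> is a junk value.
\<close>

definition nth_prime :: "nat \<Rightarrow> nat" where
  "nth_prime k = enumerate {p. prime p} (k - 1)"

definition primorial :: "nat \<Rightarrow> nat" where
  "primorial k = (\<Prod>i = 1..k. nth_prime i)"

definition primes_between :: "nat \<Rightarrow> nat \<Rightarrow> nat set" where
  "primes_between a b = {q. prime q \<and> a < q \<and> q < b}"

definition is_pos_solution :: "real \<Rightarrow> real \<Rightarrow> bool" where
  "is_pos_solution \<alpha> x \<longleftrightarrow>
     0 < x \<and> x powr (\<alpha> - 1) - pi / ((exp 1)\<^sup>2 * sqrt 3) * x + 1 = 0"

definition x0 :: "real \<Rightarrow> real" where
  "x0 \<alpha> = (THE x. is_pos_solution \<alpha> x)"

end

theory Submission
  imports Defs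
begin

text \<open>
  In fact at least \<open>n\<^sup>2\<close> primes lie in the interval, for every \<open>n \<ge> 1\<close>, which covers both
  claims. This follows from Chebyshev's lower bound \<open>2\<^sup>N\<^sup>-\<^sup>1 \<le> N\<^bsup>\<pi>(N)\<^esup>\<close>: every common multiple of
  \<open>1, \<dots>, N\<close> is a multiple of \<open>k\<close> times \<open>N choose k\<close> for all \<open>k\<close>, by the recurrence of the
  Leibniz harmonic triangle, hence is at least \<open>2\<^sup>N\<^sup>-\<^sup>1\<close>; the common multiple formed from the largest
  prime powers up to \<open>N\<close> is at most \<open>N\<^bsup>\<pi>(N)\<^esup>\<close>. Choose \<open>N\<close> to be a power of two below the primorial.
\<close>

section \<open>Chebyshev's lower bound from the Leibniz harmonic triangle\<close>

lemma leibniz_triangle: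
  fixes n k :: nat
  assumes "1 \<le> k" "k \<le> n"
  shows "1 / (real (Suc k) * real (Suc n choose Suc k)) =
         1 / (real k * real (n choose k)) - 1 / (real k * real (Suc n choose k))"
proof -
  have pos: "0 < real (n choose k)" "0 < real k" "0 < real (Suc n) - real k"
    using assms by simp_all
  \<comment> \<open>Both entries of row n + 1 are rewritten through B = \<open>n choose k\<close>;
    the claim becomes 1 / ((n+1) B) = 1 / (k B) - (n+1-k) / (k (n+1) B).\<close>
  have "Suc k * (Suc n choose Suc k) = Suc n * (n choose k)"
    using Suc_times_binomial by blast
  then have a: "real (Suc k) * real (Suc n choose Suc k) = real (Suc n) * real (n choose k)"
    by (metis of_nat_mult)
  have "(Suc n - k) * (Suc n choose k) = Suc n * (n choose k)"
    using binomial_absorb_comp by simp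
  then have "real (Suc n - k) * real (Suc n choose k) = real (Suc n) * real (n choose k)"
    by (metis of_nat_mult)
  then have b: "real (Suc n choose k) = real (Suc n) * real (n choose k) / (real (Suc n) - real k)"
    using assms by (simp add: field_simps of_nat_diff)
  show ?thesis
    unfolding a b using pos by (simp add: divide_simps)
qed

text \<open>Induction along the columns of the triangle: D takes the first column 1/n to integers
  because n divides D, and each entry of a later column is a difference of two entries of the
  previous one, both in rows at most N.\<close>

lemma common_multiple_div_leibniz:
  fixes n k N D :: nat
  assumes D: "\<And>m. 1 \<le> m \<Longrightarrow> m \<le> N \<Longrightarrow> m dvd D"
  assumes "1 \<le> k" "k \<le> n" "n \<le> N"
  shows "real D / (real k * real (n choose k)) \<in> \<int>"
  using assms(2-)
proof (induction k arbitrary: n rule: nat_induct_at_least)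
  case base
  then have "n dvd D" using D by simp
  then show ?case by (auto elim!: dvdE)
next
  case (Suc k)
  then obtain m where m: "n = Suc m" "k \<le> m" "m \<le> N" by (cases n) auto
  have "real D / (real (Suc k) * real (Suc m choose Suc k)) =
        real D / (real k * real (m choose k)) - real D / (real k * real (Suc m choose k))"
    using arg_cong[OF leibniz_triangle[OF \<open>1 \<le> k\<close> m(2)], of "\<lambda>x. real D * x"]
    by (simp add: right_diff_distrib)
  then show ?case using Suc m by (auto intro!: Ints_diff)
qed

text \<open>A positive integral quotient is at least 1, so D bounds every denominator in row N. With
  M = N - 1 these are N times the binomial coefficients of M; adding up all N of them and cancelling
  N leaves \<open>2 ^ M\<close>.\<close>

lemma common_multiple_ge:
  fixes N D :: nat
  assumes D: "\<And>m. 1 \<le> m \<Longrightarrow> m \<le> N \<Longrightarrow> m dvd D" and "0 < D" "0 < N"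
  shows "2 ^ (N - 1) \<le> D"
proof -
  obtain M where M: "N = Suc M" using \<open>0 < N\<close> by (cases N) auto
  have le: "N * (M choose k) \<le> D" if "k \<le> M" for k
  proof -
    have pos: "0 < Suc k * (N choose Suc k)" using that M by simp
    have "real D / (real (Suc k) * real (N choose Suc k)) \<in> \<int>"
      using that M by (intro common_multiple_div_leibniz[where N = N] D) simp_all
    then obtain z where z: "real D / (real (Suc k) * real (N choose Suc k)) = of_int z"
      by (auto elim: Ints_cases)
    have "0 < real D / (real (Suc k) * real (N choose Suc k))"
      using pos \<open>0 < D\<close> by (intro divide_pos_pos) (simp_all only: of_nat_mult[symmetric] of_nat_0_less_iff)
    then have "1 \<le> real D / (real (Suc k) * real (N choose Suc k))"
      unfolding z by simp
    then have "Suc k * (N choose Suc k) \<le> D"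
      using pos by (simp only: of_nat_mult[symmetric] le_divide_eq_1_pos of_nat_0_less_iff of_nat_le_iff)
    moreover have "Suc k * (N choose Suc k) = N * (M choose k)"
      using M Suc_times_binomial by blast
    ultimately show ?thesis by linarith
  qed
  have "N * 2 ^ M = (\<Sum>k\<le>M. N * (M choose k))"
    by (simp add: choose_row_sum sum_distrib_left[symmetric])
  also have "\<dots> \<le> (\<Sum>k\<le>M. D)" using le by (intro sum_mono) simp
  also have "\<dots> = N * D" using M by simp
  finally show ?thesis using M \<open>0 < N\<close> by (simp only: mult_le_cancel1 diff_Suc_1)
qed

lemma common_multiple_le:
  fixes N :: nat
  assumes "0 < N"
  obtains D where "\<And>m. 1 \<le> m \<Longrightarrow> m \<le> N \<Longrightarrow> m dvd D" "0 < D"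
    "D \<le> N ^ card {p. prime p \<and> p \<le> N}"
proof -
  define S where "S = {p::nat. prime p \<and> p \<le> N}"
  define e where "e p = (GREATEST k. p ^ k \<le> N)" for p :: nat
  define D where "D = (\<Prod>p\<in>S. p ^ e p)"
  have fin: "finite S" by (simp add: S_def)
  \<comment> \<open>\<open>GREATEST\<close> needs a bounded, nonempty set of exponents:
    \<open>k < p ^ k\<close> caps them at N, and k = 0 always qualifies because N is
    positive.\<close>
  have bound: "k \<le> N" if "prime p" "p ^ k \<le> N" for p k :: nat
    using that power_gt_expt[of p k] prime_gt_1_nat[of p] by linarith
  have e_le: "p ^ e p \<le> N" if "prime p" for p
    unfolding e_def using \<open>0 < N\<close>
    by (rule_tac GreatestI_nat[where k = 0 and b = N]) (auto intro: bound that)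
  have e_ge: "k \<le> e p" if "prime p" "p ^ k \<le> N" for p k
    unfolding e_def using that by (intro Greatest_le_nat[where b = N]) (auto intro: bound)
  have pos: "0 < D" unfolding D_def S_def by (intro prod_pos) (auto simp: prime_gt_0_nat)
  have "D \<le> (\<Prod>p\<in>S. N)" unfolding D_def using e_le by (intro prod_mono) (auto simp: S_def)
  then have "D \<le> N ^ card S" by simp
  moreover have "m dvd D" if m: "1 \<le> m" "m \<le> N" for m
  proof (rule multiplicity_le_imp_dvd)
    show "m \<noteq> 0" using m by simp
    fix p :: nat assume p: "prime p"
    have "p ^ multiplicity p m \<le> N"
      using dvd_imp_le[OF multiplicity_dvd[of p m]] m by simp
    then have 1: "multiplicity p m \<le> e p" using e_ge p by blast
    show "multiplicity p m \<le> multiplicity p D"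
    proof (cases "p \<in> S")
      case True
      then have "p ^ e p dvd D" unfolding D_def using fin by (intro dvd_prodI) auto
      then have "e p \<le> multiplicity p D"
        using pos p by (intro multiplicity_geI) (auto simp: prime_gt_1_nat)
      then show ?thesis using 1 by simp
    next
      \<comment> \<open>A prime outside S exceeds N, hence m, and cannot divide m.\<close>
      case False
      then have "\<not> p dvd m" using p m dvd_imp_le[of p m] by (auto simp: S_def)
      then show ?thesis by (simp add: not_dvd_imp_multiplicity_0)
    qed
  qed
  ultimately show thesis using pos that unfolding S_def by blast
qed

lemma chebyshev_lower_bound:
  fixes N :: nat
  assumes "0 < N"
  shows "2 ^ (N - 1) \<le> N ^ card {p. prime p \<and> p \<le> N}"
  using common_multiple_le[OF assms] common_multiple_ge[OF _ _ assms] by (metis order_trans)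

text \<open>At N = \<open>2 ^ j\<close> both sides of Chebyshev's bound are powers of 2, so
  comparing exponents replaces taking logarithms.\<close>

lemma prime_count_power_two:
  fixes j :: nat
  shows "2 ^ j - 1 \<le> j * card {p::nat. prime p \<and> p \<le> 2 ^ j}"
proof -
  have "2 ^ (2 ^ j - 1) \<le> (2::nat) ^ (j * card {p::nat. prime p \<and> p \<le> 2 ^ j})"
    using chebyshev_lower_bound[of "2 ^ j"] by (simp add: power_mult)
  then show ?thesis by simp
qed

section \<open>Indexed primes and the size of primorials\<close>

lemma infinite_primes: "infinite {p::nat. prime p}"
  using primes_infinite by simp

lemma prime_nth_prime: "prime (nth_prime k)"
  using enumerate_in_set[OF infinite_primes] by (simp add: nth_prime_def)

lemma nth_prime_less: "nth_prime (Suc k) < nth_prime (Suc (Suc k))"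
  unfolding nth_prime_def using enumerate_step[OF infinite_primes] by simp

text \<open>Strict growth, with 4 and 6 excluded as composite, yields the first four bounds. From
  the fifth prime on, 8 suffices and, being a power of two, makes the primorial easy to compare with
  powers of two.\<close>

lemma nth_prime_ge:
  shows "2 \<le> nth_prime 1" "3 \<le> nth_prime 2" "5 \<le> nth_prime 3" "7 \<le> nth_prime 4"
    and "8 \<le> nth_prime (Suc (k + 4))"
proof -
  note less = nth_prime_less[of 0] nth_prime_less[of 1] nth_prime_less[of 2] nth_prime_less[of 3]
  have p: "\<not> prime (4::nat)" "\<not> prime (6::nat)" by simp_all
  show 1: "2 \<le> nth_prime 1" using prime_nth_prime prime_ge_2_nat by blast
  show 2: "3 \<le> nth_prime 2" using 1 less(1) by (simp add: numeral_eq_Suc)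
  have "nth_prime 3 \<noteq> 4" using prime_nth_prime[of 3] p by metis
  then show 3: "5 \<le> nth_prime 3" using 2 less(2) by (simp add: numeral_eq_Suc)
  have "nth_prime 4 \<noteq> 6" using prime_nth_prime[of 4] p by metis
  then show 4: "7 \<le> nth_prime 4" using 3 less(3) by (simp add: numeral_eq_Suc)
  show "8 \<le> nth_prime (Suc (k + 4))"
  proof (induction k)
    case 0
    then show ?case using 4 less(4) by (simp add: numeral_eq_Suc)
  next
    case (Suc k)
    then show ?case using nth_prime_less[of "k + 4"] by simp
  qed
qed

lemma primorial_Suc: "primorial (Suc k) = primorial k * nth_prime (Suc k)"
  by (simp add: primorial_def)

lemma primorial_ge:
  shows "6 \<le> primorial 2" "30 \<le> primorial 3" "210 * 8 ^ k \<le> primorial (k + 4)"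
proof -
  have eq: "primorial 2 = primorial 1 * nth_prime 2" "primorial 3 = primorial 2 * nth_prime 3"
    "primorial 4 = primorial 3 * nth_prime 4"
    using primorial_Suc[of 1] primorial_Suc[of 2] primorial_Suc[of 3]
    by (simp_all add: numeral_eq_Suc)
  have 1: "2 \<le> primorial 1" using nth_prime_ge(1) by (simp add: primorial_def)
  show 2: "6 \<le> primorial 2" using mult_mono[OF 1 nth_prime_ge(2)] eq by simp
  show 3: "30 \<le> primorial 3" using mult_mono[OF 2 nth_prime_ge(3)] eq by simp
  have 4: "210 \<le> primorial 4" using mult_mono[OF 3 nth_prime_ge(4)] eq by simp
  show "210 * 8 ^ k \<le> primorial (k + 4)"
  proof (induction k)
    case 0
    then show ?case using 4 by simp
  next
    case (Suc k)
    then show ?case using mult_mono[OF Suc nth_prime_ge(5)[of k]] primorial_Suc[of "k + 4"] by simp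
  qed
qed

lemma card_primes_le_nth_prime: "card {p. prime p \<and> p \<le> nth_prime (n + 1)} = n + 1"
proof -
  let ?S = "{p::nat. prime p}"
  have bij: "bij_betw (enumerate ?S) UNIV ?S" by (rule bij_enumerate[OF infinite_primes])
  \<comment> \<open>\<open>enumerate\<close> counts from 0, so the primes up to
    \<open>nth_prime (n + 1)\<close> are those with indices 0 to n.\<close>
  have "{p. prime p \<and> p \<le> nth_prime (n + 1)} = enumerate ?S ` {..n}"
  proof (intro equalityI subsetI)
    fix p assume p: "p \<in> {p. prime p \<and> p \<le> nth_prime (n + 1)}"
    then obtain i where i: "p = enumerate ?S i" using bij by (auto simp: bij_betw_def)
    then have "i \<le> n"
      using p enumerate_mono[of n i ?S] infinite_primes by (force simp: nth_prime_def)
    then show "p \<in> enumerate ?S ` {..n}" using i by simp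
  next
    fix p assume "p \<in> enumerate ?S ` {..n}"
    then obtain i where i: "p = enumerate ?S i" "i \<le> n" by auto
    then show "p \<in> {p. prime p \<and> p \<le> nth_prime (n + 1)}"
      using enumerate_in_set[OF infinite_primes, of i] infinite_primes
      by (auto simp: nth_prime_def)
  qed
  moreover have "inj_on (enumerate ?S) {..n}"
    using bij by (auto simp: bij_betw_def intro: inj_on_subset)
  ultimately show ?thesis by (simp add: card_image)
qed

section \<open>Counting primes between \<open>nth_prime (n + 1)\<close> and the primorial\<close>

lemma card_primes_between_nth_prime_ge:
  assumes "finite T" "\<And>q. q \<in> T \<Longrightarrow> prime q \<and> q < primorial (n + 1)"
  shows "card T - (n + 1) \<le> card (primes_between (nth_prime (n + 1)) (primorial (n + 1)))"
proof -
  \<comment> \<open>Discarding from T the primes up to \<open>nth_prime (n + 1)\<close> removes at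
    most n + 1 elements; what remains lies in the interval.\<close>
  have "card T - (n + 1) \<le> card (T - {p. prime p \<and> p \<le> nth_prime (n + 1)})"
    using diff_card_le_card_Diff[of "{p. prime p \<and> p \<le> nth_prime (n + 1)}" T]
    by (simp add: card_primes_le_nth_prime[simplified])
  also have "\<dots> \<le> card (primes_between (nth_prime (n + 1)) (primorial (n + 1)))"
    using assms by (intro card_mono) (auto simp: primes_between_def)
  finally show ?thesis .
qed

text \<open>With n = k + 3 and j = 3k + 7 this reads j (n^2 + n) + 2 \<le> 2^j. The 2 absorbs the -1
  of \<open>prime_count_power_two\<close> and still leaves a strict inequality. The induction works
  because the left side grows by a factor of at most 8 per step.\<close>

lemma power_two_gt_cubic:
  fixes k :: nat
  shows "(3 * k + 7) * ((k + 3)\<^sup>2 + (k + 3)) + 2 \<le> 2 ^ (3 * k + 7)"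
proof (induction k)
  case 0
  then show ?case by simp
next
  case (Suc k)
  have "(3 * Suc k + 7) * ((Suc k + 3)\<^sup>2 + (Suc k + 3)) + 2
        \<le> 8 * ((3 * k + 7) * ((k + 3)\<^sup>2 + (k + 3)) + 2)"
    by (simp add: power2_eq_square algebra_simps)
  also have "\<dots> \<le> 8 * 2 ^ (3 * k + 7)" using Suc by simp
  also have "\<dots> = 2 ^ (3 * Suc k + 7)" by (simp add: power_add)
  finally show ?case .
qed

lemma square_le_card_primes_between:
  assumes "0 < n"
  shows "n\<^sup>2 \<le> card (primes_between (nth_prime (n + 1)) (primorial (n + 1)))"
proof -
  \<comment> \<open>The bound \<open>210 * 8 ^ k\<close> requires n + 1 \<ge> 4. The two smaller
    cases list primes explicitly: 3 - 2 = 1 remain below 6, and 7 - 3 = 4 remain below 30.\<close>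
  consider "n = 1" | "n = 2" | k where "n = k + 3"
    using assms le_Suc_ex[of 3 n] by (force simp: add.commute)
  then show ?thesis
  proof cases
    case 1
    have "prime q \<and> q < primorial (n + 1)" if "q \<in> {2, 3, 5}" for q
      using that primorial_ge(1) 1 by (auto simp: numeral_2_eq_2[symmetric])
    from card_primes_between_nth_prime_ge[OF _ this, of "{2, 3, 5}"] show ?thesis using 1 by simp
  next
    case 2
    have primes: "prime (2::nat)" "prime (3::nat)" "prime (5::nat)" "prime (7::nat)"
      "prime (11::nat)" "prime (13::nat)" "prime (17::nat)"
      by simp_all
    have "prime q \<and> q < primorial (n + 1)" if "q \<in> {2, 3, 5, 7, 11, 13, 17}" for q
      using that primorial_ge(2) 2 primes by auto
    from card_primes_between_nth_prime_ge[OF _ this, of "{2, 3, 5, 7, 11, 13, 17}"]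
    show ?thesis using 2 by simp
  next
    case (3 k)
    \<comment> \<open>The exponent comes from 2^7 = 128 < 210 together with 3 for each further
      factor 8.\<close>
    let ?T = "{p::nat. prime p \<and> p \<le> 2 ^ (3 * k + 7)}"
    have "(2::nat) ^ (3 * k + 7) = 128 * 8 ^ k" by (simp add: power_add power_mult)
    also have "\<dots> < 210 * 8 ^ k" by simp
    also have "\<dots> \<le> primorial (n + 1)" using primorial_ge(3)[of k] 3 by (simp add: ac_simps)
    finally have "card ?T - (n + 1) \<le> card (primes_between (nth_prime (n + 1)) (primorial (n + 1)))"
      by (intro card_primes_between_nth_prime_ge) auto
    moreover have "(3 * k + 7) * (n\<^sup>2 + n) < (3 * k + 7) * card ?T"
      using power_two_gt_cubic[of k] prime_count_power_two[of "3 * k + 7"] unfolding 3 by linarith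
    \<comment> \<open>Strictness means at least n^2 + n + 1 primes, so n^2 survive the removal of n
      + 1.\<close>
    then have "n\<^sup>2 + n < card ?T" by (simp only: mult_less_cancel1)
    ultimately show ?thesis by linarith
  qed
qed

section \<open>Unique solvability of the equation for \<open>x0\<close>, and the final
  theorem\<close>

lemma ex1_pos_solution:
  assumes \<alpha>: "1 < \<alpha>" "\<alpha> < 2"
  shows "\<exists>!x. is_pos_solution \<alpha> x"
proof -
  define c where "c = pi / ((exp 1)\<^sup>2 * sqrt 3)"
  have c: "0 < c" by (simp add: c_def)
  \<comment> \<open>Dividing the equation by x turns it into \<open>g x = c\<close>. Both exponents
    in g are negative, so g decreases strictly to 0 and takes the positive value c at most
    once.\<close>
  define g where "g x = x powr (\<alpha> - 2) + 1 / x" for x :: real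
  have iff: "is_pos_solution \<alpha> x \<longleftrightarrow> 0 < x \<and> g x = c" for x
  proof -
    have "x powr (\<alpha> - 1) = x powr (\<alpha> - 2) * x" if "0 < x"
      using that powr_add[of x "\<alpha> - 2" 1] by simp
    then show ?thesis
      unfolding is_pos_solution_def g_def c_def[symmetric] by (auto simp: field_simps)
  qed
  have dec: "g y < g x" if "0 < x" "x < y" for x y
    unfolding g_def using that \<alpha>
    by (intro add_strict_mono powr_less_mono2_neg) (auto simp: frac_less2)
  have "(g \<longlongrightarrow> 0 + 0) at_top"
    unfolding g_def using \<alpha>
    by (intro tendsto_add tendsto_neg_powr filterlim_ident real_tendsto_divide_at_top) auto
  then have "\<forall>\<^sub>F x in at_top. g x < c"
    using c by (intro order_tendstoD(2)[where y = 0]) auto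
  then obtain X where X: "\<And>x. X \<le> x \<Longrightarrow> g x < c" by (auto simp: eventually_at_top_linorder)
  \<comment> \<open>Endpoints for the intermediate value theorem: at 1/c the summand 1/x alone
    already equals c, and from X on g is below c.\<close>
  define b where "b = max X (1 / c)"
  have "continuous_on {1 / c..b} g"
    unfolding g_def using c less_le_trans[of 0 "1 / c"] by (intro continuous_intros) force+
  moreover have "g b \<le> c" using X[of b] by (simp add: b_def)
  moreover have "c \<le> g (1 / c)" using c by (simp add: g_def)
  moreover have "1 / c \<le> b" by (simp add: b_def)
  ultimately obtain x where x: "1 / c \<le> x" "g x = c" using IVT2'[of g b c "1 / c"] by blast
  have x0: "0 < x" using x(1) c less_le_trans[of 0 "1 / c" x] by simp
  show ?thesis
  proof (rule ex1I)
    show "is_pos_solution \<alpha> x" using x x0 iff by simp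
    show "y = x" if "is_pos_solution \<alpha> y" for y
      using that x x0 dec[of x y] dec[of y x] iff by (cases x y rule: linorder_cases) auto
  qed
qed

theorem theorem1:
  shows "(\<forall>\<alpha>::real. 1 < \<alpha> \<and> \<alpha> < 2 \<longrightarrow>
            (\<exists>!x. is_pos_solution \<alpha> x) \<and>
            (\<forall>n::nat. 0 < n \<and> x0 \<alpha> < real n \<longrightarrow>
               \<lfloor>real n powr \<alpha>\<rfloor>
                 \<le> int (card (primes_between (nth_prime (n + 1)) (primorial (n + 1)))))) \<and>
         (\<forall>n::nat. 0 < n \<longrightarrow>
            n \<le> card (primes_between (nth_prime (n + 1)) (primorial (n + 1))))"
proof (intro conjI allI impI; (elim conjE)?)
  fix \<alpha> :: real
  assume \<alpha>: "1 < \<alpha>" "\<alpha> < 2"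
  show "\<exists>!x. is_pos_solution \<alpha> x" by (rule ex1_pos_solution[OF \<alpha>])
  fix n :: nat
  assume n: "0 < n"
  have "real n powr \<alpha> \<le> real n powr 2" using \<alpha> n by (intro powr_mono) auto
  also have "\<dots> = real (n\<^sup>2)" using n by simp
  finally have "\<lfloor>real n powr \<alpha>\<rfloor> \<le> int (n\<^sup>2)" by linarith
  also have "\<dots> \<le> int (card (primes_between (nth_prime (n + 1)) (primorial (n + 1))))"
    using square_le_card_primes_between[OF n] by linarith
  finally show "\<lfloor>real n powr \<alpha>\<rfloor>
      \<le> int (card (primes_between (nth_prime (n + 1)) (primorial (n + 1))))" .
next
  fix n :: nat
  assume n: "0 < n"
  have "n \<le> n\<^sup>2" by (simp add: power2_eq_square)
  also note square_le_card_primes_between[OF n]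
  finally show "n \<le> card (primes_between (nth_prime (n + 1)) (primorial (n + 1)))" .
qed

end
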